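(* For every integer $k \geq 2$, $RR(\mathcal{E}(2k,0)) = 2k$ and $RR(\mathcal{E}(2k-1,0)) = 3k-1$. Furthermore, $RR(\mathcal{E}(2,0)) = 5$ and $RR(\mathcal{E}(1,0)) = 11$.
   Context: For a positive integer $k$ and an integer $j > -k$, $\mathcal{E}(k,j)$ denotes the equation $x+y+kz=(k+j)w$. A $2$-coloring of $[1,N]=\{1,2,\dots,N\}$ is a map $\chi:[1,N]\to\{0,1\}$; a solution $(x,y,z,w)$ with $x,y,z,w\in[1,N]$ (not necessarily distinct) is monochromatic if $\chi(x)=\chi(y)=\chi(z)=\chi(w)$. For an equation $\mathcal{E}$, $RR(\mathcal{E})$ denotes the minimum positive integer $N$ such that every $2$-coloring of $[1,N]$ admits a monochromatic solution to $\mathcal{E}$ in $[1,N]$. *)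

theory Defs
  imports Main "HOL-Library.Extended_Nat" "HOL-Library.FuncSet"
begin

text \<open>The equation \<open>x + y + k z = (k + j) w\<close>, for \<open>k > 0\<close> and \<open>j > - k\<close>. It is stated over
  the integers because \<open>j\<close> may be negative.\<close>

definition equation_E :: "nat \<Rightarrow> int \<Rightarrow> nat \<Rightarrow> nat \<Rightarrow> nat \<Rightarrow> nat \<Rightarrow> bool" where
  "equation_E k j x y z w \<longleftrightarrow>
     int x + int y + int k * int z = (int k + j) * int w"

text \<open>Only the values of \<open>\<chi>\<close> on \<open>{1..N}\<close> matter.\<close>

definition two_coloring :: "nat \<Rightarrow> (nat \<Rightarrow> nat) \<Rightarrow> bool" where
  "two_coloring N \<chi> \<longleftrightarrow> \<chi> \<in> {1..N} \<rightarrow> {0, 1}"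

definition has_mono_solution ::
    "(nat \<Rightarrow> nat \<Rightarrow> nat \<Rightarrow> nat \<Rightarrow> bool) \<Rightarrow> nat \<Rightarrow> (nat \<Rightarrow> nat) \<Rightarrow> bool" where
  "has_mono_solution E N \<chi> \<longleftrightarrow>
     (\<exists>x\<in>{1..N}. \<exists>y\<in>{1..N}. \<exists>z\<in>{1..N}. \<exists>w\<in>{1..N}.
        E x y z w \<and> \<chi> x = \<chi> y \<and> \<chi> y = \<chi> z \<and> \<chi> z = \<chi> w)"

text \<open>The value is \<open>\<infinity>\<close> if no such \<open>N\<close> exists, so an equation \<open>RR E = enat n\<close> includes the
  claim that the minimum exists.\<close>

definition RR :: "(nat \<Rightarrow> nat \<Rightarrow> nat \<Rightarrow> nat \<Rightarrow> bool) \<Rightarrow> enat" where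
  "RR E = Inf {enat N | N. N > 0 \<and> (\<forall>\<chi>. two_coloring N \<chi> \<longrightarrow> has_mono_solution E N \<chi>)}"

end

theory Submission
  imports Defs
begin

text \<open>
  Put \<open>d = w - z\<close>: a solution of \<open>\<E>(n,0)\<close> consists of a pair with \<open>x + y = n d\<close> and a pair
  \<open>z, z + d\<close>. Below \<open>n\<close> the only possible difference is \<open>1\<close>, so the colouring by parity avoids
  solutions for \<open>n = 2k\<close>. For \<open>n = 2k - 1\<close> the differences on \<open>[1, 3k - 2]\<close> are \<open>1\<close> and \<open>2\<close>; a
  colouring in alternating blocks of length two excludes \<open>d = 2\<close>, and \<open>d = 1\<close> is excluded if a
  block starts at \<open>k\<close>, since then \<open>x\<close> and \<open>2k - 1 - x\<close> have different colours.

  Conversely, a colouring without solutions is forced to have these shapes. For \<open>n = 2k\<close> the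
  pairs \<open>(k, k)\<close> and \<open>(k - 1, k + 1)\<close>, of sum \<open>n\<close> and of different colours, force the colours to
  alternate, and then \<open>x = y = w = 2k\<close>, \<open>z = 2k - 2\<close> is a solution. For \<open>n = 2k - 1\<close> the pairs
  \<open>(2k - 1, 2k - 1)\<close> and \<open>(2k - 3, 2k + 1)\<close>, of sum \<open>2n\<close>, force blocks of length two, the pair
  \<open>(k - 1, k)\<close> forces a block to start at \<open>k\<close>, and \<open>(3k - 2, 3k - 1)\<close>, of sum \<open>3n\<close>, gives a
  solution with \<open>d = 3\<close>.
\<close>

lemma has_mono_solution_mono:
  assumes "has_mono_solution E M \<chi>" "M \<le> N"
  shows "has_mono_solution E N \<chi>"
proof -
  have "{1..M} \<subseteq> {1..N}"
    using assms(2) by simp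
  with assms(1) show ?thesis
    unfolding has_mono_solution_def by (blast dest: subsetD)
qed

text \<open>Solutions survive in larger intervals, so one colouring without solutions on
  \<open>[1, N - 1]\<close> rules out every smaller \<open>M\<close> too; it has to be a
  two-colouring on each of these intervals.\<close>

lemma RR_eqI:
  assumes "N > 0"
    and upper: "\<And>\<chi>. two_coloring N \<chi> \<Longrightarrow> has_mono_solution E N \<chi>"
    and lower: "\<And>M. two_coloring M \<chi>" "\<not> has_mono_solution E (N - 1) \<chi>"
  shows "RR E = enat N"
  unfolding RR_def
proof (rule antisym)
  show "Inf {enat N |N. N > 0 \<and> (\<forall>\<chi>. two_coloring N \<chi> \<longrightarrow> has_mono_solution E N \<chi>)} \<le> enat N"
    using assms(1) upper by (intro Inf_lower) auto
  have "N \<le> M" if "has_mono_solution E M \<chi>" for M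
    using has_mono_solution_mono[OF that, of "N - 1"] lower(2) by linarith
  then show "enat N \<le> Inf {enat N |N. N > 0 \<and> (\<forall>\<chi>. two_coloring N \<chi> \<longrightarrow> has_mono_solution E N \<chi>)}"
    using lower(1) by (intro Inf_greatest) auto
qed

lemma equation_E_0: "equation_E n 0 x y z w \<longleftrightarrow> x + y + n * z = n * w"
  by (simp add: equation_E_def flip: of_nat_add of_nat_mult)

lemma mono_solutionI:
  assumes "x + y = n * d" "z + d = w" "\<chi> x = \<chi> y" "\<chi> y = \<chi> z" "\<chi> z = \<chi> w"
    and "0 < x" "x \<le> N" "0 < y" "y \<le> N" "0 < z" "w \<le> N"
  shows "has_mono_solution (equation_E n 0) N \<chi>"
  unfolding has_mono_solution_def equation_E_0
  using assms
  by (intro bexI[of _ x] bexI[of _ y] bexI[of _ z] bexI[of _ w]) (auto simp: algebra_simps)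

lemma mono_solutionE:
  assumes "has_mono_solution (equation_E n 0) N \<chi>" "n > 0"
  obtains x y z d where "x + y = n * d" "\<chi> x = \<chi> y" "\<chi> y = \<chi> z" "\<chi> z = \<chi> (z + d)"
    "0 < d" "0 < x" "x \<le> N" "0 < y" "y \<le> N" "0 < z" "z + d \<le> N"
proof -
  obtain x y z w where s: "x \<in> {1..N}" "y \<in> {1..N}" "z \<in> {1..N}" "w \<in> {1..N}"
      "x + y + n * z = n * w" "\<chi> x = \<chi> y" "\<chi> y = \<chi> z" "\<chi> z = \<chi> w"
    using assms(1) unfolding has_mono_solution_def equation_E_0 by blast
  have "n * z < n * w"
    using s(1,5) by (simp only: atLeastAtMost_iff) linarith
  then have "z < w"
    by simp
  then obtain d where "w = z + d" "d > 0"
    using less_imp_add_positive by blast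
  with s show thesis
    by (intro that[of x y d z]) (auto simp: algebra_simps)
qed

lemma two_coloring_eq:
  assumes "two_coloring N \<chi>" "0 < a" "a \<le> N" "0 < b" "b \<le> N" "0 < c" "c \<le> N"
    and "\<chi> a \<noteq> \<chi> b" "\<chi> b \<noteq> \<chi> c"
  shows "\<chi> a = \<chi> c"
proof -
  have "\<chi> x \<in> {0, 1}" if "0 < x" "x \<le> N" for x
    using assms(1) that by (auto simp: two_coloring_def Pi_iff)
  from this[of a] this[of b] this[of c] assms(2-) show ?thesis
    by auto
qed

lemma even_upper:
  assumes "k \<ge> 2" and col: "two_coloring (2 * k) \<chi>"
  shows "has_mono_solution (equation_E (2 * k) 0) (2 * k) \<chi>"
proof (rule ccontr)
  assume "\<not> ?thesis"
  note free = mono_solutionI[where \<chi> = \<chi>, THEN notE[OF this, where R = False]]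
  note eq = two_coloring_eq[OF col]
  have l: "\<chi> (k - 1) \<noteq> \<chi> k"
    by (intro notI free[of k k 1 "k - 1" k]) (use assms(1) in auto)
  have "\<chi> k \<noteq> \<chi> (k + 1)"
    by (intro notI free[of k k 1 k "k + 1"]) (use assms(1) in auto)
  with l have lr: "\<chi> (k - 1) = \<chi> (k + 1)"
    using eq[of "k - 1" k "k + 1"] assms(1) by auto
  \<comment> \<open>The pairs \<open>(k, k)\<close> and \<open>(k - 1, k + 1)\<close> realise both
    colours, so one of them has the colour of \<open>z\<close>.\<close>
  have step: "\<chi> z \<noteq> \<chi> (z + 1)" if "0 < z" "z + 1 \<le> 2 * k" for z
  proof
    assume z: "\<chi> z = \<chi> (z + 1)"
    show False
    proof (cases "\<chi> z = \<chi> k")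
      case True
      then show False
        by (intro free[of k k 1 z "z + 1"]) (use z that assms(1) in auto)
    next
      case False
      then have "\<chi> z = \<chi> (k - 1)"
        using eq[of z k "k - 1"] l that assms(1) by auto
      then show False
        by (intro free[of "k - 1" "k + 1" 1 z "z + 1"]) (use lr z that assms(1) in auto)
    qed
  qed
  have "2 * k - 2 + 1 = 2 * k - 1" "2 * k - 1 + 1 = 2 * k"
    using assms(1) by auto
  then have "\<chi> (2 * k - 2) = \<chi> (2 * k)"
    using eq[of "2 * k - 2" "2 * k - 1" "2 * k"] step[of "2 * k - 2"] step[of "2 * k - 1"] assms(1)
    by auto
  then show False
    by (intro free[of "2 * k" "2 * k" 2 "2 * k - 2" "2 * k"]) (use assms(1) in auto)
qed

lemma even_lower:
  assumes "k \<ge> 1"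
  shows "\<not> has_mono_solution (equation_E (2 * k) 0) (2 * k - 1) (\<lambda>x. x mod 2)"
proof
  assume "has_mono_solution (equation_E (2 * k) 0) (2 * k - 1) (\<lambda>x. x mod 2)"
  then show False
  proof (rule mono_solutionE)
    fix x y z d :: nat
    assume "x + y = 2 * k * d" "x \<le> 2 * k - 1" "y \<le> 2 * k - 1" "0 < d"
    then have "2 * k * d < 2 * k * 2"
      using assms by linarith
    then have "d = 1"
      using \<open>0 < d\<close> by simp
    moreover assume "z mod 2 = (z + d) mod 2"
    ultimately show False
      by presburger
  qed (use assms in auto)
qed

lemma odd_upper:
  assumes "k \<ge> 2" and col: "two_coloring (3 * k - 1) \<chi>"
  shows "has_mono_solution (equation_E (2 * k - 1) 0) (3 * k - 1) \<chi>"
proof (rule ccontr)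
  assume "\<not> ?thesis"
  note free = mono_solutionI[where \<chi> = \<chi>, THEN notE[OF this, where R = False]]
  note eq = two_coloring_eq[OF col]
  \<comment> \<open>The pair \<open>(2 * k - 3, 2 * k + 1)\<close> just fits: for
    \<open>k = 2\<close> it consists of the endpoints \<open>1\<close> and \<open>5\<close> of the
    interval.\<close>
  have l: "\<chi> (2 * k - 3) \<noteq> \<chi> (2 * k - 1)"
    by (intro notI free[of "2 * k - 1" "2 * k - 1" 2 "2 * k - 3" "2 * k - 1"])
      (use assms(1) in auto)
  have "\<chi> (2 * k - 1) \<noteq> \<chi> (2 * k + 1)"
    by (intro notI free[of "2 * k - 1" "2 * k - 1" 2 "2 * k - 1" "2 * k + 1"])
      (use assms(1) in auto)
  with l have lr: "\<chi> (2 * k - 3) = \<chi> (2 * k + 1)"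
    using eq[of "2 * k - 3" "2 * k - 1" "2 * k + 1"] assms(1) by auto
  have step: "\<chi> z \<noteq> \<chi> (z + 2)" if "0 < z" "z + 2 \<le> 3 * k - 1" for z
  proof
    assume z: "\<chi> z = \<chi> (z + 2)"
    show False
    proof (cases "\<chi> z = \<chi> (2 * k - 1)")
      case True
      then show False
        by (intro free[of "2 * k - 1" "2 * k - 1" 2 z "z + 2"]) (use z that assms(1) in auto)
    next
      case False
      then have "\<chi> z = \<chi> (2 * k - 3)"
        using eq[of z "2 * k - 1" "2 * k - 3"] l that assms(1) by auto
      then show False
        by (intro free[of "2 * k - 3" "2 * k + 1" 2 z "z + 2"]) (use lr z that assms(1) in auto)
    qed
  qed
  \<comment> \<open>With two colours, \<open>z + 1\<close> agrees with exactly one of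
    \<open>z\<close> and \<open>z + 2\<close>.\<close>
  have flip: "\<chi> (z + 1) = \<chi> (z + 2) \<longleftrightarrow> \<chi> z \<noteq> \<chi> (z + 1)" if "0 < z" "z + 2 \<le> 3 * k - 1" for z
    using eq[of z "z + 1" "z + 2"] step[OF that] that by auto
  have "\<chi> (k - 1) \<noteq> \<chi> k"
    by (intro notI free[of "k - 1" k 1 "k - 1" k]) (use assms(1) in auto)
  have block: "\<chi> (k - 1 + j) = \<chi> (k - 1 + j + 1) \<longleftrightarrow> odd j" if "j \<le> 2 * k - 1" for j
    using that
  proof (induction j)
    case 0
    then show ?case
      using \<open>\<chi> (k - 1) \<noteq> \<chi> k\<close> assms(1) by simp
  next
    case (Suc j)
    then have "0 < k - 1 + j" "k - 1 + j + 2 \<le> 3 * k - 1"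
      using assms(1) by auto
    from flip[OF this] Suc show ?case
      by simp
  qed
  have "k - 1 + (2 * k - 1) = 3 * k - 2" "3 * k - 2 + 1 = 3 * k - 1"
    "k - 1 + (2 * k - 2) = 3 * k - 3" "3 * k - 3 + 1 = 3 * k - 2"
    using assms(1) by auto
  then have *: "\<chi> (3 * k - 2) = \<chi> (3 * k - 1)" "\<chi> (3 * k - 3) \<noteq> \<chi> (3 * k - 2)"
    using block[of "2 * k - 1"] block[of "2 * k - 2"] assms(1) by (simp_all only:) auto
  \<comment> \<open>The final solution has \<open>w = 3 * k - 2\<close> and \<open>d = 3\<close>,
    hence \<open>z = 3 * k - 5\<close>, which is positive since \<open>k \<ge> 2\<close>.\<close>
  have "3 * k - 5 + 2 = 3 * k - 3"
    using assms(1) by auto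
  then have "\<chi> (3 * k - 5) = \<chi> (3 * k - 2)"
    using eq[of "3 * k - 5" "3 * k - 3" "3 * k - 2"] * step[of "3 * k - 5"] assms(1) by auto
  then show False
    by (intro free[of "3 * k - 2" "3 * k - 1" 3 "3 * k - 5" "3 * k - 2"]) (use * assms(1) in auto)
qed

text \<open>The residues modulo \<open>4\<close> are \<open>0\<close> and \<open>3\<close> or
  \<open>1\<close> and \<open>2\<close>, and the blocks are \<open>{0, 1}\<close> and
  \<open>{2, 3}\<close>.\<close>

lemma color_sum: "a + b + 1 = 4 * m \<Longrightarrow> a div 2 mod 2 \<noteq> b div 2 mod 2" for a b m :: nat
  by presburger

lemma color_shift: "a div 2 mod 2 \<noteq> (a + 2) div 2 mod 2" for a :: nat
  by presburger

text \<open>The blocks of length two, \<open>3 k\<close> standing for \<open>- k\<close> modulo \<open>4\<close>.\<close>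

lemma odd_lower:
  assumes "k \<ge> 1"
  shows "\<not> has_mono_solution (equation_E (2 * k - 1) 0) (3 * k - 2) (\<lambda>x. (x + 3 * k) div 2 mod 2)"
proof
  assume "has_mono_solution (equation_E (2 * k - 1) 0) (3 * k - 2) (\<lambda>x. (x + 3 * k) div 2 mod 2)"
  then show False
  proof (rule mono_solutionE)
    fix x y z d :: nat
    assume sum: "x + y = (2 * k - 1) * d" and "x \<le> 3 * k - 2" "y \<le> 3 * k - 2" "0 < d"
    \<comment> \<open>Here \<open>x + y \<le> 6 * k - 4\<close>, one less than the sum that
      \<open>d = 3\<close> requires.\<close>
    then have "(2 * k - 1) * d < (2 * k - 1) * 3"
      using assms by linarith
    then have "d = 1 \<or> d = 2"
      using \<open>0 < d\<close> by (simp only: mult_less_cancel1) auto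
    moreover assume color: "(x + 3 * k) div 2 mod 2 = (y + 3 * k) div 2 mod 2"
    have "x + 3 * k + (y + 3 * k) + 1 = 4 * (2 * k)" if "d = 1"
      using sum assms that by (simp only: mult_1_right)
    then have "d \<noteq> 1"
      using color_sum color by blast
    moreover assume "(z + 3 * k) div 2 mod 2 = (z + d + 3 * k) div 2 mod 2"
    then have "d \<noteq> 2"
      using color_shift[of "z + 3 * k"] by (auto simp: ac_simps)
    ultimately show False
      by blast
  qed (use assms in auto)
qed

text \<open>For \<open>k = 1\<close> the pair \<open>(k - 1, k + 1)\<close> would contain
  \<open>0\<close>. The witness is forced on \<open>[1, 4]\<close> up to swapping colours.\<close>

lemma RR_E2: "RR (equation_E 2 0) = enat 5"
proof (rule RR_eqI[where \<chi> = "\<lambda>x. if x \<in> {1, 4} then 0 else 1"])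
  fix \<chi> assume col: "two_coloring 5 \<chi>"
  show "has_mono_solution (equation_E 2 0) 5 \<chi>"
  proof (rule ccontr)
    assume "\<not> ?thesis"
    note free = mono_solutionI[where \<chi> = \<chi>, THEN notE[OF this, where R = False]]
    note eq = two_coloring_eq[OF col]
    have "\<chi> 1 \<noteq> \<chi> 2" "\<chi> 2 \<noteq> \<chi> 4"
      using free[of 1 1 1 1 2] free[of 2 2 2 2 4] by auto
    moreover from this have "\<chi> 1 = \<chi> 4"
      using eq[of 1 2 4] by auto
    moreover from this have "\<chi> 4 \<noteq> \<chi> 5"
      using free[of 1 1 1 4 5] by auto
    moreover from calculation have "\<chi> 2 = \<chi> 5"
      using eq[of 2 4 5] by auto
    moreover have "\<chi> 4 \<noteq> \<chi> 3"
      using free[of 1 1 1 3 4] \<open>\<chi> 1 = \<chi> 4\<close> by auto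
    moreover from calculation have "\<chi> 3 = \<chi> 5"
      using eq[of 3 4 5] by auto
    ultimately show False
      using free[of 3 3 3 2 5] by auto
  qed
next
  have "{1..5 - 1} = {1, 2, 3, 4::nat}"
    by auto
  then show "\<not> has_mono_solution (equation_E 2 0) (5 - 1) (\<lambda>x. if x \<in> {1, 4} then 0 else 1)"
    unfolding has_mono_solution_def equation_E_0 by simp
qed (auto simp: two_coloring_def)

text \<open>The equation is \<open>x + y + z = w\<close>. Three terms from \<open>{1, 2}\<close> sum
  to a value in \<open>{3..6}\<close>, three from \<open>{3..8}\<close> to at least
  \<open>9\<close>, and a sum with a term \<open>9\<close> or \<open>10\<close> exceeds
  \<open>10\<close>.\<close>

lemma RR_E1: "RR (equation_E 1 0) = enat 11"
proof (rule RR_eqI[where \<chi> = "\<lambda>x. if x \<in> {3..8} then 0 else 1"])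
  fix \<chi> assume col: "two_coloring 11 \<chi>"
  show "has_mono_solution (equation_E 1 0) 11 \<chi>"
  proof (rule ccontr)
    assume "\<not> ?thesis"
    note free = mono_solutionI[where \<chi> = \<chi>, THEN notE[OF this, where R = False]]
    note eq = two_coloring_eq[OF col]
    have "\<chi> 1 \<noteq> \<chi> 3" "\<chi> 3 \<noteq> \<chi> 9"
      using free[of 1 1 2 1 3] free[of 3 3 6 3 9] by auto
    moreover from this have "\<chi> 1 = \<chi> 9"
      using eq[of 1 3 9] by auto
    moreover from this have "\<chi> 9 \<noteq> \<chi> 11" "\<chi> 9 \<noteq> \<chi> 4"
      using free[of 1 1 2 9 11] free[of 4 4 8 1 9] by auto
    moreover from calculation have "\<chi> 3 = \<chi> 11" "\<chi> 3 = \<chi> 4"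
      using eq[of 3 9 11] eq[of 3 9 4] by auto
    ultimately show False
      using free[of 4 4 8 3 11] by auto
  qed
next
  show "\<not> has_mono_solution (equation_E 1 0) (11 - 1) (\<lambda>x. if x \<in> {3..8} then 0 else 1)"
    unfolding has_mono_solution_def equation_E_0 by (auto split: if_splits)
qed (auto simp: two_coloring_def)

theorem theorem3:
  shows "(\<forall>k::nat. k \<ge> 2 \<longrightarrow>
            RR (equation_E (2 * k) 0) = enat (2 * k) \<and>
            RR (equation_E (2 * k - 1) 0) = enat (3 * k - 1)) \<and>
         RR (equation_E 2 0) = enat 5 \<and>
         RR (equation_E 1 0) = enat 11"
proof (intro conjI allI impI)
  fix k :: nat
  assume k: "k \<ge> 2"
  show "RR (equation_E (2 * k) 0) = enat (2 * k)"
    using k even_lower[of k] by (intro RR_eqI[OF _ even_upper, where \<chi> = "\<lambda>x. x mod 2"]) (auto simp: two_coloring_def)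
  have "3 * k - 1 - 1 = 3 * k - 2"
    by simp
  then show "RR (equation_E (2 * k - 1) 0) = enat (3 * k - 1)"
    using k odd_lower[of k] 
    by (intro RR_eqI[OF _ odd_upper, where \<chi> = "\<lambda>x. (x + 3 * k) div 2 mod 2"])
       (auto simp: two_coloring_def)
qed (fact RR_E2 RR_E1)+

end
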